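(* Let $V$ be a complex vector space and let $A=(V,\bullet)$ and $B=(V,\circ)$ be two associative algebra structures on $V$, where $A$ is semisimple and $B$ is the matrix algebra $M_n(\mathbb{C})$ (that is, $B\cong M_n(\mathbb{C})$ as algebras, $n\ge1$). Let $(V,\succ,\prec)$ be a post-associative algebra structure on $(A,B)$. Then $A\cong B$, and either $x\succ y=x\prec y=0$ and $x\circ y=x\bullet y$ for all $x,y\in V$, or $x\bullet y=x\succ y=x\prec y=-x\circ y$ for all $x,y\in V$.
   Context: A semisimple associative algebra is a finite-dimensional associative algebra with zero Jacobson radical. Given two associative products $A=(V,\bullet)$ and $B=(V,\circ)$ on the same vector space $V$, a post-associative algebra structure on the pair $(A,B)$ is a pair of bilinear products $\succ,\prec$ on $V$ such that for all $x,y,z\in V$: (1) $x\bullet y-x\circ y=x\succ y+x\prec y$; (2) $(x\bullet y)\succ z=x\succ(y\succ z)$; (3) $x\prec(y\bullet z)=(x\prec y)\prec z$; (4) $x\succ(y\circ z)=(x\succ y)\circ z$; (5) $(x\circ y)\prec z=x\circ(y\prec z)$; (6) $(x\prec y)\circ z=x\circ(y\succ z)$. *)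

theory Defs
  imports "HOL-Analysis.Analysis"
begin

section \<open>Associative algebras\<close>

text \<open>The vector space is the whole type \<open>'v\<close> with an explicit scalar multiplication, so that
  several products can live on it. Algebras are not required to have a unit.\<close>

definition (in vector_space) bilinear_product :: "('b \<Rightarrow> 'b \<Rightarrow> 'b) \<Rightarrow> bool" where
  "bilinear_product m \<longleftrightarrow>
     (\<forall>x. Vector_Spaces.linear scale scale (\<lambda>y. m x y)) \<and>
     (\<forall>y. Vector_Spaces.linear scale scale (\<lambda>x. m x y))"

locale assoc_algebra = vector_space scale
  for scale :: "'k::field \<Rightarrow> 'v::ab_group_add \<Rightarrow> 'v" +
  fixes mult :: "'v \<Rightarrow> 'v \<Rightarrow> 'v"  (infixl "\<cdot>" 70)
  assumes bilinear: "bilinear_product (\<cdot>)"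
    and assoc: "(x \<cdot> y) \<cdot> z = x \<cdot> (y \<cdot> z)"
begin

definition left_ideal :: "'v set \<Rightarrow> bool" where
  "left_ideal L \<longleftrightarrow> subspace L \<and> (\<forall>a. \<forall>x\<in>L. a \<cdot> x \<in> L)"

text \<open>In the absence of a unit, the Jacobson radical is the intersection of the maximal left ideals
  that are modular, i.e. have a right unit modulo the ideal. In a unital algebra every left ideal
  is modular. If there are no modular maximal left ideals, the intersection is the whole algebra.\<close>

definition modular_left_ideal :: "'v set \<Rightarrow> bool" where
  "modular_left_ideal L \<longleftrightarrow> left_ideal L \<and> (\<exists>e. \<forall>x. x - x \<cdot> e \<in> L)"

definition maximal_left_ideal :: "'v set \<Rightarrow> bool" where
  "maximal_left_ideal L \<longleftrightarrow> left_ideal L \<and> L \<noteq> UNIV \<and>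
     (\<forall>L'. left_ideal L' \<and> L \<subseteq> L' \<longrightarrow> L' = L \<or> L' = UNIV)"

definition jacobson_radical :: "'v set" where
  "jacobson_radical = \<Inter> {L. maximal_left_ideal L \<and> modular_left_ideal L}"

end

locale semisimple_algebra = assoc_algebra scale mult
  for scale :: "'k::field \<Rightarrow> 'v::ab_group_add \<Rightarrow> 'v" and mult +
  assumes finite_dimensional: "\<exists>Basis. finite_dimensional_vector_space scale Basis"
    and radical_zero: "jacobson_radical = {0}"

definition algebra_isomorphic ::
  "('k::field \<Rightarrow> 'v::ab_group_add \<Rightarrow> 'v) \<Rightarrow> ('v \<Rightarrow> 'v \<Rightarrow> 'v) \<Rightarrow>
   ('k \<Rightarrow> 'w::ab_group_add \<Rightarrow> 'w) \<Rightarrow> ('w \<Rightarrow> 'w \<Rightarrow> 'w) \<Rightarrow> bool" where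
  "algebra_isomorphic s1 m1 s2 m2 \<longleftrightarrow>
     (\<exists>\<phi>. Vector_Spaces.linear s1 s2 \<phi> \<and> bij \<phi> \<and> (\<forall>x y. \<phi> (m1 x y) = m2 (\<phi> x) (\<phi> y)))"

section \<open>Matrix algebras\<close>

text \<open>On matrices the library's \<open>*s\<close> and \<open>*\<^sub>R\<close> do not give multiplication by a complex scalar.\<close>

definition matrix_scale :: "'k::field \<Rightarrow> 'k^'n^'n \<Rightarrow> 'k^'n^'n" where
  "matrix_scale c M = (\<chi> i j. c * M $ i $ j)"

lemma assoc_algebra_matrix:
  "assoc_algebra matrix_scale ((**) :: 'k::field^'n^'n \<Rightarrow> _)"
proof -
  interpret M: vector_space "matrix_scale :: 'k \<Rightarrow> 'k^'n^'n \<Rightarrow> _"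
    by unfold_locales (simp_all add: matrix_scale_def vec_eq_iff algebra_simps)
  show ?thesis
    by unfold_locales
       (auto simp: M.bilinear_product_def Vector_Spaces.linear_iff M.vector_space_axioms
          matrix_add_ldistrib matrix_mul_assoc,
        auto simp: matrix_scale_def matrix_matrix_mult_def vec_eq_iff sum_distrib_left
          algebra_simps sum.distrib)
qed

section \<open>Post-associative algebra structures\<close>

locale post_associative_structure =
  A: assoc_algebra scale multA + B: assoc_algebra scale multB
  for scale :: "'k::field \<Rightarrow> 'v::ab_group_add \<Rightarrow> 'v"
    and multA :: "'v \<Rightarrow> 'v \<Rightarrow> 'v"  (infixl "\<cdot>\<^sub>A" 70)
    and multB :: "'v \<Rightarrow> 'v \<Rightarrow> 'v"  (infixl "\<cdot>\<^sub>B" 70) +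
  fixes succ :: "'v \<Rightarrow> 'v \<Rightarrow> 'v"  (infixl "\<succ>" 70)
    and prec :: "'v \<Rightarrow> 'v \<Rightarrow> 'v"  (infixl "\<prec>" 70)
  assumes bilinear_succ: "A.bilinear_product (\<succ>)"
    and bilinear_prec: "A.bilinear_product (\<prec>)"
    and diff_eq: "x \<cdot>\<^sub>A y - x \<cdot>\<^sub>B y = x \<succ> y + x \<prec> y"
    and multA_succ: "(x \<cdot>\<^sub>A y) \<succ> z = x \<succ> (y \<succ> z)"
    and prec_multA: "x \<prec> (y \<cdot>\<^sub>A z) = (x \<prec> y) \<prec> z"
    and succ_multB: "x \<succ> (y \<cdot>\<^sub>B z) = (x \<succ> y) \<cdot>\<^sub>B z"
    and multB_prec: "(x \<cdot>\<^sub>B y) \<prec> z = x \<cdot>\<^sub>B (y \<prec> z)"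
    and prec_multB: "(x \<prec> y) \<cdot>\<^sub>B z = x \<cdot>\<^sub>B (y \<succ> z)"

end

theory Submission
  imports Defs
begin

text \<open>Let \<open>1\<close> be the unit of \<open>B = M\<^sub>n\<close> and \<open>T x = x \<succ> 1\<close>. The axioms give \<open>x \<succ> y = T x \<circ> y\<close> and
  \<open>x \<prec> y = x \<circ> T y\<close>, so \<open>T\<close> is a Rota--Baxter operator of weight 1 on \<open>B\<close>: both \<open>\<rho> = T\<close> and
  \<open>\<pi> = T + id\<close> are homomorphisms from \<open>A\<close> to \<open>B\<close>, and \<open>\<pi> - \<rho>\<close> is bijective. One has to show that
  \<open>\<rho>\<close> or \<open>\<pi>\<close> vanishes.

  Since \<open>A\<close> is semisimple in characteristic 0, its regular trace form is nondegenerate, which provides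
  a unit \<open>u\<close> and a symmetric Casimir element. From \<open>(1 - \<pi> u) (\<pi> x - \<rho> x) (1 - \<rho> u) = 0\<close> one of
  \<open>\<pi> u\<close>, \<open>\<rho> u\<close> is \<open>1\<close>, by symmetry \<open>\<pi> u\<close>. As \<open>\<rho> A\<close> lies in the corner of the idempotent
  \<open>\<rho> u \<noteq> 1\<close>, an orthogonality argument for the matrix trace form shows that only scalars commute with
  \<open>\<pi> A\<close>. The Casimir element then shows that \<open>\<pi>\<close> is onto, so \<open>A\<close> is simple and \<open>\<rho> = 0\<close>.\<close>

section \<open>The trace of an endomorphism\<close>

locale fd_vector_space = finite_dimensional_vector_space scale Basis
  for scale :: "'k::field \<Rightarrow> 'v::ab_group_add \<Rightarrow> 'v" and Basis
begin

definition op_trace :: "('v \<Rightarrow> 'v) \<Rightarrow> 'k" where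
  "op_trace f = (\<Sum>b\<in>Basis. representation Basis (f b) b)"

lemma sum_representation_Basis:
  "(\<Sum>b\<in>Basis. scale (representation Basis v b) b) = v"
  by (rule sum_representation_eq) (auto simp: independent_Basis span_Basis finite_Basis)

lemma rep_add: "representation Basis (x + y) b = representation Basis x b + representation Basis y b"
  by (simp add: representation_add independent_Basis span_Basis)

lemma rep_scale: "representation Basis (scale c x) b = c * representation Basis x b"
  by (simp add: representation_scale independent_Basis span_Basis)

lemma rep_sum: "representation Basis (\<Sum>i\<in>I. f i) b = (\<Sum>i\<in>I. representation Basis (f i) b)"
  by (simp add: representation_sum independent_Basis span_Basis)

lemma rep_basis: "b \<in> Basis \<Longrightarrow> representation Basis b c = (if c = b then 1 else 0)"
  by (simp add: representation_basis independent_Basis)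

lemma linear_expand:
  assumes "Vector_Spaces.linear scale s f"
  shows "f v = (\<Sum>b\<in>Basis. s (representation Basis v b) (f b))"
proof -
  interpret f: Vector_Spaces.linear scale s f by fact
  have "f v = f (\<Sum>b\<in>Basis. scale (representation Basis v b) b)"
    by (simp add: sum_representation_Basis)
  then show ?thesis by (simp add: f.sum f.scale)
qed

lemma op_trace_add: "op_trace (\<lambda>x. f x + g x) = op_trace f + op_trace g"
  by (simp add: op_trace_def rep_add sum.distrib)

lemma op_trace_scale: "op_trace (\<lambda>x. scale c (f x)) = c * op_trace f"
  by (simp add: op_trace_def rep_scale sum_distrib_left)

lemma op_trace_commute:
  assumes f: "Vector_Spaces.linear scale scale f" and g: "Vector_Spaces.linear scale scale g"
  shows "op_trace (\<lambda>x. f (g x)) = op_trace (\<lambda>x. g (f x))"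
proof -
  let ?r = "representation Basis"
  have *: "op_trace (\<lambda>x. f (g x)) = (\<Sum>b\<in>Basis. \<Sum>c\<in>Basis. ?r (g b) c * ?r (f c) b)"
    if "Vector_Spaces.linear scale scale f" for f g
    unfolding op_trace_def
    by (intro sum.cong refl, subst linear_expand[OF that]) (simp add: rep_sum rep_scale)
  show ?thesis
    unfolding *[OF f] *[OF g] by (subst sum.swap) (simp add: mult.commute)
qed

text \<open>Let \<open>C\<close> be a basis of the range. As \<open>f\<close> takes values in the
  span of \<open>C\<close>, exchanging the two sums turns its trace into the trace of
  \<open>f\<close> restricted to that span, where \<open>f\<close> is the identity.\<close>

lemma op_trace_idempotent:
  assumes f: "Vector_Spaces.linear scale scale f" and idem: "\<And>x. f (f x) = f x"
  shows "op_trace f = of_nat (dim (range f))"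
proof -
  interpret f: Vector_Spaces.linear scale scale f by fact
  obtain C where C: "C \<subseteq> range f" "independent C" "range f \<subseteq> span C" "card C = dim (range f)"
    using basis_exists[of "range f"] by metis
  have fin: "finite C" using C(2) by (rule finiteI_independent)
  have fC: "f c = c" if "c \<in> C" for c using that C(1) idem by auto
  let ?r = "\<lambda>x c. representation C (f x) c"
  have rlin: "?r (\<Sum>b\<in>Basis. scale (k b) b) c = (\<Sum>b\<in>Basis. k b * ?r b c)" for k c
  proof -
    have sp: "f x \<in> span C" for x using C(3) by auto
    then have "scale (k b) (f b) \<in> span C" for b by (simp add: span_scale)
    then show ?thesis
      using C(2) sp by (simp add: f.sum f.scale representation_sum representation_scale)
  qed
  have "op_trace f = (\<Sum>b\<in>Basis. representation Basis (\<Sum>c\<in>C. scale (?r b c) c) b)"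
    unfolding op_trace_def using C(3)
    by (intro sum.cong refl arg_cong2[where f="representation Basis"] arg_cong[where f="\<lambda>x. representation Basis x _"]
        sum_representation_eq[symmetric]) (auto simp: C fin subsetD[OF C(3)])
  also have "\<dots> = (\<Sum>c\<in>C. \<Sum>b\<in>Basis. representation Basis c b * ?r b c)"
    by (subst sum.swap) (simp add: rep_sum rep_scale mult.commute)
  \<comment> \<open>By \<open>rlin\<close>, the inner sum is the coordinate of \<open>f\<close> at
    the recombined expansion of \<open>c\<close> in \<open>Basis\<close>.\<close>
  also have "\<dots> = (\<Sum>c\<in>C. ?r c c)"
    by (simp add: rlin[symmetric] sum_representation_Basis)
  also have "\<dots> = (\<Sum>c\<in>C. 1)"
    by (intro sum.cong refl) (simp add: fC representation_basis C(2))
  finally show ?thesis by (simp add: C(4))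
qed

end

section \<open>The regular trace form\<close>

context assoc_algebra
begin

lemma linear_mult: "Vector_Spaces.linear scale scale (\<lambda>y. x \<cdot> y)"
  and linear_mult': "Vector_Spaces.linear scale scale (\<lambda>x. x \<cdot> y)"
  using bilinear by (auto simp: bilinear_product_def)

lemma mult_add_right: "x \<cdot> (y + z) = x \<cdot> y + x \<cdot> z"
  and mult_diff_right: "x \<cdot> (y - z) = x \<cdot> y - x \<cdot> z"
  and mult_zero_right [simp]: "x \<cdot> 0 = 0"
  and mult_scale_right: "x \<cdot> scale c y = scale c (x \<cdot> y)"
  and mult_sum_right: "x \<cdot> (\<Sum>i\<in>I. f i) = (\<Sum>i\<in>I. x \<cdot> f i)"
proof -
  interpret l: Vector_Spaces.linear scale scale "\<lambda>y. x \<cdot> y" by (rule linear_mult)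
  show "x \<cdot> (y + z) = x \<cdot> y + x \<cdot> z" "x \<cdot> (y - z) = x \<cdot> y - x \<cdot> z" "x \<cdot> 0 = 0"
    "x \<cdot> scale c y = scale c (x \<cdot> y)" "x \<cdot> (\<Sum>i\<in>I. f i) = (\<Sum>i\<in>I. x \<cdot> f i)"
    by (simp_all add: l.add l.diff l.zero l.scale l.sum)
qed

lemma mult_add_left: "(y + z) \<cdot> x = y \<cdot> x + z \<cdot> x"
  and mult_diff_left: "(y - z) \<cdot> x = y \<cdot> x - z \<cdot> x"
  and mult_zero_left [simp]: "0 \<cdot> x = 0"
  and mult_scale_left: "scale c y \<cdot> x = scale c (y \<cdot> x)"
  and mult_sum_left: "(\<Sum>i\<in>I. f i) \<cdot> x = (\<Sum>i\<in>I. f i \<cdot> x)"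
proof -
  interpret l: Vector_Spaces.linear scale scale "\<lambda>y. y \<cdot> x" by (rule linear_mult')
  show "(y + z) \<cdot> x = y \<cdot> x + z \<cdot> x" "(y - z) \<cdot> x = y \<cdot> x - z \<cdot> x" "0 \<cdot> x = 0"
    "scale c y \<cdot> x = scale c (y \<cdot> x)" "(\<Sum>i\<in>I. f i) \<cdot> x = (\<Sum>i\<in>I. f i \<cdot> x)"
    by (simp_all add: l.add l.diff l.zero l.scale l.sum)
qed

text \<open>As there is no unit, \<open>pow x k\<close> is \<open>x\<^sup>k\<^sup>+\<^sup>1\<close>.\<close>

primrec pow :: "'v \<Rightarrow> nat \<Rightarrow> 'v" where
  "pow x 0 = x"
| "pow x (Suc k) = x \<cdot> pow x k"

lemma pow_mult: "pow x i \<cdot> pow x j = pow x (Suc (i + j))"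
  by (induction i) (simp_all add: assoc)

text \<open>Modulo \<open>M\<close>, right multiplication by \<open>n\<close> is the identity, so
  \<open>n\<close> is congruent to all its powers and finally to 0.\<close>

lemma left_ideal_nilpotent_mem:
  assumes M: "left_ideal M" and n: "\<And>x. x - x \<cdot> n \<in> M" and k: "pow n k = 0"
  shows "n \<in> M"
proof -
  have sub: "subspace M" using M by (simp add: left_ideal_def)
  have "n - pow n j \<in> M" for j
  proof (induction j)
    case 0
    then show ?case using sub by (simp add: subspace_0)
  next
    case (Suc j)
    have "pow n j - pow n j \<cdot> n \<in> M" by (rule n)
    moreover have "pow n j \<cdot> n = pow n (Suc j)"
      using pow_mult[of n j 0] by simp
    ultimately have "(n - pow n j) + (pow n j - pow n (Suc j)) \<in> M"
      using Suc subspace_add[OF sub] by metis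
    then show ?case by simp
  qed
  from this[of k] k show ?thesis by simp
qed

text \<open>If \<open>M + N\<close> is everything, split the right unit modulo \<open>M\<close> as
  \<open>e = m + n\<close>. Then \<open>n\<close> is also a right unit modulo \<open>M\<close>;
  being nilpotent it lies in \<open>M\<close>, which makes \<open>M\<close> everything. Otherwise
  \<open>M + N = M\<close> already contains \<open>N\<close>.\<close>

lemma nil_ideal_subset_jacobson_radical:
  assumes N: "left_ideal N" and nil: "\<And>x. x \<in> N \<Longrightarrow> \<exists>k. pow x k = 0"
  shows "N \<subseteq> jacobson_radical"
  unfolding jacobson_radical_def
proof (intro Inter_greatest, safe)
  fix M x assume max: "maximal_left_ideal M" and mod: "modular_left_ideal M" and "x \<in> N"
  have M: "left_ideal M" "M \<noteq> UNIV"
    and maxD: "\<And>L. left_ideal L \<Longrightarrow> M \<subseteq> L \<Longrightarrow> L = M \<or> L = UNIV"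
    using max by (auto simp: maximal_left_ideal_def)
  obtain e where e: "\<And>x. x - x \<cdot> e \<in> M" using mod by (auto simp: modular_left_ideal_def)
  have sM: "subspace M" and sN: "subspace N" using M N by (auto simp: left_ideal_def)
  let ?L = "{m + n | m n. m \<in> M \<and> n \<in> N}"
  have "left_ideal ?L"
    unfolding left_ideal_def
  proof (intro conjI allI ballI)
    show "subspace ?L" using subspace_sums[OF sM sN] by simp
    fix a y assume "y \<in> ?L"
    then show "a \<cdot> y \<in> ?L" using M N by (force simp: mult_add_right left_ideal_def)
  qed
  moreover have "M \<subseteq> ?L" using subspace_0[OF sN] by force
  ultimately consider "?L = M" | "?L = UNIV" using maxD by blast
  then show "x \<in> M"
  proof cases
    case 1
    then show ?thesis using \<open>x \<in> N\<close> subspace_0[OF sM] by force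
  next
    case 2
    then have "e \<in> ?L" by simp
    then obtain m n where mn: "e = m + n" "m \<in> M" "n \<in> N" by blast
    have xn: "y - y \<cdot> n \<in> M" for y
    proof -
      have "y \<cdot> m \<in> M" using M mn by (simp add: left_ideal_def)
      then have "(y - y \<cdot> e) + y \<cdot> m \<in> M" using e[of y] sM by (simp add: subspace_add)
      then show ?thesis by (simp add: mn mult_add_right algebra_simps)
    qed
    obtain k where "pow n k = 0" using nil mn by blast
    then have "n \<in> M" using left_ideal_nilpotent_mem[OF M(1) xn] by blast
    then have "y \<cdot> n \<in> M" for y using M by (simp add: left_ideal_def)
    then have "y \<in> M" for y using subspace_add[OF sM xn[of y], of "y \<cdot> n"] by simp
    then show ?thesis .
  qed
qed

end

section \<open>Idempotents and the radical of the trace form\<close>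

locale fd_assoc_algebra =
  assoc_algebra scale mult + fd_vector_space scale Basis
  for scale :: "'k::field \<Rightarrow> 'v::ab_group_add \<Rightarrow> 'v" and mult (infixl "\<cdot>" 70) and Basis
begin

text \<open>The spans of \<open>x\<^sup>j\<close> for \<open>j > k\<close> become stationary; multiplication by \<open>x\<^sup>k\<^sup>+\<^sup>1\<close> is then onto
  such a span, and the element acting trivially on \<open>x\<^sup>k\<^sup>+\<^sup>1\<close> is the idempotent.\<close>

lemma idempotent_of_non_nilpotent:
  assumes "\<And>k. pow x k \<noteq> 0"
  obtains k y where "pow x k \<cdot> y \<noteq> 0" "(pow x k \<cdot> y) \<cdot> (pow x k \<cdot> y) = pow x k \<cdot> y"
proof -
  define S where "S k = span (pow x ` {k..})" for k
  obtain k where k: "\<And>j. dim (S k) \<le> dim (S j)"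
    using ex_has_least_nat[of "\<lambda>_. True" 0 "\<lambda>j. dim (S j)"] by auto
  have Sk: "S (Suc (k + k)) = S k"
  proof (rule subspace_dim_equal)
    show "S (Suc (k + k)) \<subseteq> S k" unfolding S_def by (intro span_mono image_mono) auto
  qed (simp_all add: k, simp_all add: S_def)
  have "pow x k \<in> S k" by (auto simp: S_def intro: span_base)
  then have mem: "pow x k \<in> S (Suc (k + k))" by (simp only: Sk)
  \<comment> \<open>Index \<open>j\<close> stands for the exponent \<open>j + 1\<close>, so
    multiplication by \<open>pow x k\<close> raises indices by \<open>k + 1\<close>.\<close>
  have S2: "S (Suc (k + j)) = (\<lambda>y. pow x k \<cdot> y) ` S j" for j
  proof -
    interpret l: Vector_Spaces.linear scale scale "\<lambda>y. pow x k \<cdot> y" by (rule linear_mult)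
    have "i \<in> (\<lambda>i. Suc (k + i)) ` {j..}" if "Suc (k + j) \<le> i" for i
      using that by (intro image_eqI[of _ _ "i - Suc k"]) auto
    then have "{Suc (k + j)..} = (\<lambda>i. Suc (k + i)) ` {j..}" by auto
    then have "pow x ` {Suc (k + j)..} = (\<lambda>y. pow x k \<cdot> y) ` pow x ` {j..}"
      by (simp add: image_image pow_mult)
    then show ?thesis by (simp add: S_def l.span_image)
  qed
  have comm: "s \<cdot> pow x j = pow x j \<cdot> s" if "s \<in> S i" for s i j
    using that unfolding S_def
  proof (induction rule: span_induct_alt)
    case base
    then show ?case by simp
  next
    case (step c a b)
    then show ?case
      by (auto simp: mult_add_left mult_add_right mult_scale_left mult_scale_right pow_mult add.commute)
  qed
  obtain s where s: "s \<in> S k" "pow x k = pow x k \<cdot> s" using mem unfolding S2 by auto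
  have "s \<in> S (Suc (k + k))" using s by (simp only: Sk)
  then obtain y where y: "s = pow x k \<cdot> y" unfolding S2 by auto
  have "s \<cdot> s = (s \<cdot> pow x k) \<cdot> y" by (simp add: assoc y)
  also have "\<dots> = pow x k \<cdot> y" using comm[OF s(1)] s(2) by simp
  finally have "s \<cdot> s = s" by (simp add: y)
  moreover have "s \<noteq> 0" using s(2) assms[of k] by auto
  ultimately show ?thesis using that y by metis
qed

definition tr_form :: "'v \<Rightarrow> 'v \<Rightarrow> 'k" where
  "tr_form x y = op_trace (\<lambda>z. (x \<cdot> y) \<cdot> z)"

lemma tr_form_commute: "tr_form x y = tr_form y x"
  unfolding tr_form_def assoc by (rule op_trace_commute) (rule linear_mult)+

lemma tr_form_assoc: "tr_form (x \<cdot> y) z = tr_form x (y \<cdot> z)"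
  by (simp add: tr_form_def assoc)

lemma tr_form_cycle: "tr_form (x \<cdot> y) z = tr_form y (z \<cdot> x)"
  using tr_form_commute[of x "y \<cdot> z"] by (simp add: tr_form_assoc)

lemma tr_form_add_right: "tr_form x (y + z) = tr_form x y + tr_form x z"
  by (simp add: tr_form_def mult_add_left mult_add_right op_trace_add)

lemma tr_form_scale_right: "tr_form x (scale c y) = c * tr_form x y"
  by (simp add: tr_form_def mult_scale_left mult_scale_right op_trace_scale)

lemma tr_form_add_left: "tr_form (y + z) x = tr_form y x + tr_form z x"
  by (simp add: tr_form_commute[of _ x] tr_form_add_right)

lemma tr_form_scale_left: "tr_form (scale c y) x = c * tr_form y x"
  by (simp add: tr_form_commute[of _ x] tr_form_scale_right)

lemma tr_form_zero_left [simp]: "tr_form 0 x = 0"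
  using tr_form_scale_left[of 0] by simp

lemma tr_form_diff_left: "tr_form (y - z) x = tr_form y x - tr_form z x"
  using tr_form_add_left[of "y - z" z x] by simp

lemma tr_form_sum_left: "tr_form (\<Sum>i\<in>I. f i) x = (\<Sum>i\<in>I. tr_form (f i) x)"
  by (induction I rule: infinite_finite_induct) (simp_all add: tr_form_add_left)

lemma tr_form_sum_right: "tr_form x (\<Sum>i\<in>I. f i) = (\<Sum>i\<in>I. tr_form x (f i))"
  by (simp add: tr_form_commute[of x] tr_form_sum_left)

end

locale fd_assoc_algebra_char_0 = fd_assoc_algebra scale mult Basis
  for scale :: "'k::field_char_0 \<Rightarrow> 'v::ab_group_add \<Rightarrow> 'v" and mult (infixl "\<cdot>" 70) and Basis
begin

lemma tr_form_radical_nil: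
  assumes "\<And>y. tr_form x y = 0"
  shows "\<exists>k. pow x k = 0"
proof (rule ccontr)
  \<comment> \<open>An idempotent in \<open>x \<cdot> A\<close> is in the radical of the form, so its multiplication operator has
    trace 0, that is, rank 0.\<close>
  assume "\<nexists>k. pow x k = 0"
  then obtain k y where s: "pow x k \<cdot> y \<noteq> 0"
    "(pow x k \<cdot> y) \<cdot> (pow x k \<cdot> y) = pow x k \<cdot> y"
    using idempotent_of_non_nilpotent by metis
  define s where "s = pow x k \<cdot> y"
  have ss: "s \<cdot> s = s" and "s \<noteq> 0" using s by (simp_all add: s_def)
  have "\<exists>z. s = x \<cdot> z"
    by (cases k) (auto simp: s_def assoc)
  then obtain z where z: "s = x \<cdot> z" by blast
  have "tr_form s s = 0" using assms[of "z \<cdot> s"] by (simp add: z tr_form_assoc)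
  then have "op_trace (\<lambda>z. s \<cdot> z) = 0" by (simp add: tr_form_def ss)
  moreover have "op_trace (\<lambda>z. s \<cdot> z) = of_nat (dim (range (\<lambda>z. s \<cdot> z)))"
    by (rule op_trace_idempotent[OF linear_mult]) (simp add: assoc[symmetric] ss)
  \<comment> \<open>Characteristic 0 enters here: a rank whose image in the field vanishes is
    0.\<close>
  ultimately have "dim (range (\<lambda>z. s \<cdot> z)) = 0" by simp
  then have "s \<cdot> s = 0" by (auto simp only: dim_eq_0 image_subset_iff)
  then show False using ss \<open>s \<noteq> 0\<close> by simp
qed

text \<open>The radical of the form is a left ideal by cyclic invariance and nil by
  \<open>tr_form_radical_nil\<close>, so it lies in the Jacobson radical.\<close>

lemma tr_form_nondegenerate:
  assumes "jacobson_radical = {0}" and "\<And>y. tr_form x y = 0"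
  shows "x = 0"
proof -
  let ?N = "{x. \<forall>y. tr_form x y = 0}"
  have "left_ideal ?N"
    unfolding left_ideal_def
  proof (intro conjI allI ballI)
    show "subspace ?N"
      by (rule subspaceI) (auto simp: tr_form_add_left tr_form_scale_left)
    fix a x assume "x \<in> ?N"
    moreover have "tr_form (a \<cdot> x) y = tr_form x (y \<cdot> a)" for y
      by (rule tr_form_cycle)
    ultimately show "a \<cdot> x \<in> ?N" by simp
  qed
  then have "?N \<subseteq> jacobson_radical"
    by (rule nil_ideal_subset_jacobson_radical) (simp add: tr_form_radical_nil)
  then show ?thesis using assms by auto
qed

end

section \<open>Dual bases, the unit and the Casimir element\<close>

locale nondegenerate_algebra = fd_assoc_algebra scale mult Basis
  for scale :: "'k::field \<Rightarrow> 'v::ab_group_add \<Rightarrow> 'v" and mult (infixl "\<cdot>" 70) and Basis +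
  assumes nondegenerate: "(\<And>y. tr_form x y = 0) \<Longrightarrow> x = 0"
begin

lemma tr_form_eqI:
  assumes "\<And>b. b \<in> Basis \<Longrightarrow> tr_form x b = tr_form y b"
  shows "x = y"
proof -
  have "tr_form x z = tr_form y z" for z
    by (subst (1 2) sum_representation_Basis[of z, symmetric])
      (simp add: tr_form_sum_right tr_form_scale_right assms)
  then have "x - y = 0" by (intro nondegenerate) (simp add: tr_form_diff_left)
  then show ?thesis by simp
qed

text \<open>The linear map \<open>?h\<close> records the values of the form on \<open>Basis\<close>
  as coordinates. Nondegeneracy makes it injective, hence onto in finite dimension.\<close>

lemma tr_form_represents:
  obtains z where "\<And>b. b \<in> Basis \<Longrightarrow> tr_form z b = f b"
proof -
  let ?h = "\<lambda>z. \<Sum>b\<in>Basis. scale (tr_form z b) b"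
  have rep: "representation Basis (\<Sum>b\<in>Basis. scale (k b) b) c = k c" if "c \<in> Basis" for k c
    using that by (simp add: rep_sum rep_scale rep_basis finite_Basis if_distrib cong: if_cong)
  have lin: "Vector_Spaces.linear scale scale ?h"
    by unfold_locales
      (simp_all add: tr_form_add_left tr_form_scale_left scale_left_distrib sum.distrib scale_sum_right)
  have "inj ?h"
  proof (rule injI)
    fix x y assume "?h x = ?h y"
    then have "tr_form x b = tr_form y b" if "b \<in> Basis" for b
      using rep[OF that, of "tr_form x"] rep[OF that, of "tr_form y"] by simp
    then show "x = y" by (rule tr_form_eqI)
  qed
  then have "surj ?h" using linear_inj_imp_surj[OF lin] by simp
  then obtain z where "(\<Sum>b\<in>Basis. scale (f b) b) = ?h z" by (blast dest: surjD)
  then have "tr_form z b = f b" if "b \<in> Basis" for b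
    using rep[OF that, of "tr_form z"] rep[OF that, of f] by simp
  then show ?thesis by (rule that)
qed

definition dual :: "'v \<Rightarrow> 'v" where
  "dual b = (SOME z. \<forall>c\<in>Basis. tr_form z c = (if c = b then 1 else 0))"

lemma tr_form_dual: "c \<in> Basis \<Longrightarrow> tr_form (dual b) c = (if c = b then 1 else 0)"
proof -
  obtain z where "\<forall>c\<in>Basis. tr_form z c = (if c = b then 1 else 0)"
    using tr_form_represents[of "\<lambda>c. if c = b then 1 else 0"] by metis
  from someI[of "\<lambda>z. \<forall>c\<in>Basis. tr_form z c = (if c = b then 1 else 0)", OF this]
  show "c \<in> Basis \<Longrightarrow> tr_form (dual b) c = (if c = b then 1 else 0)"
    by (auto simp: dual_def)
qed

lemma rep_eq_tr_form_dual: "b \<in> Basis \<Longrightarrow> representation Basis x b = tr_form (dual b) x"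
  by (subst (2) sum_representation_Basis[of x, symmetric])
    (simp add: tr_form_sum_right tr_form_scale_right tr_form_dual finite_Basis if_distrib cong: if_cong)

lemma expand_dual: "x = (\<Sum>b\<in>Basis. scale (tr_form x b) (dual b))"
  by (rule tr_form_eqI)
    (simp add: tr_form_sum_left tr_form_scale_left tr_form_dual finite_Basis if_distrib cong: if_cong)

text \<open>This element represents the regular trace with respect to \<open>tr_form\<close>, as
  \<open>tr_form_unit\<close> shows. That property, with nondegeneracy, makes it a two-sided
  unit.\<close>

definition unit :: 'v where
  "unit = (\<Sum>b\<in>Basis. b \<cdot> dual b)"

text \<open>After cycling, each summand is the \<open>b\<close>-coordinate of
  \<open>x \<cdot> b\<close>, a diagonal entry of left multiplication by \<open>x\<close>.\<close>

lemma tr_form_unit: "tr_form unit x = op_trace (\<lambda>z. x \<cdot> z)"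
proof -
  have "tr_form (b \<cdot> dual b) x = tr_form (dual b) (x \<cdot> b)" for b
    by (rule tr_form_cycle)
  then show ?thesis
    by (simp add: unit_def tr_form_sum_left op_trace_def rep_eq_tr_form_dual)
qed

lemma unit_left: "unit \<cdot> x = x"
proof (rule tr_form_eqI)
  fix b show "tr_form (unit \<cdot> x) b = tr_form x b"
    unfolding tr_form_assoc tr_form_unit by (simp add: tr_form_def)
qed

lemma unit_right: "x \<cdot> unit = x"
proof (rule tr_form_eqI)
  fix b
  have "tr_form (x \<cdot> unit) b = tr_form unit (b \<cdot> x)"
    by (rule tr_form_cycle)
  also have "\<dots> = tr_form x b" 
    by (subst (2) tr_form_commute) (simp only: tr_form_unit, simp only: tr_form_def)
  finally show "tr_form (x \<cdot> unit) b = tr_form x b" .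
qed

text \<open>The Casimir element \<open>\<Sum>b. dual b \<otimes> b\<close> commutes with the algebra. As there are no tensor
  products here, it is tested against an arbitrary bilinear map.\<close>

lemma casimir:
  assumes l: "\<And>x. Vector_Spaces.linear scale s (F x)"
    and r: "\<And>y. Vector_Spaces.linear scale s (\<lambda>x. F x y)"
  shows "(\<Sum>b\<in>Basis. F (dual b \<cdot> c) b) = (\<Sum>b\<in>Basis. F (dual b) (c \<cdot> b))"
    and "(\<Sum>b\<in>Basis. F (c \<cdot> dual b) b) = (\<Sum>b\<in>Basis. F (dual b) (b \<cdot> c))"
proof -
  have L: "F x y = (\<Sum>d\<in>Basis. s (tr_form (dual d) y) (F x d))" for x y
    using linear_expand[OF l, of x y] by (simp add: rep_eq_tr_form_dual)
  have R: "F x y = (\<Sum>d\<in>Basis. s (tr_form x d) (F (dual d) y))" for x y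
  proof -
    interpret f: Vector_Spaces.linear scale s "\<lambda>x. F x y" by (rule r)
    show ?thesis by (subst expand_dual[of x]) (simp add: f.sum f.scale)
  qed
  \<comment> \<open>Expanding the argument that contains \<open>c\<close> on either side gives
    double sums over \<open>F (dual d) b\<close>, with coefficients
    \<open>tr_form (dual b \<cdot> c) d\<close> and
    \<open>tr_form (dual b) (c \<cdot> d)\<close>.\<close>
  show "(\<Sum>b\<in>Basis. F (dual b \<cdot> c) b) = (\<Sum>b\<in>Basis. F (dual b) (c \<cdot> b))"
    by (subst L, subst R, subst sum.swap) (simp only: tr_form_assoc)
  show "(\<Sum>b\<in>Basis. F (c \<cdot> dual b) b) = (\<Sum>b\<in>Basis. F (dual b) (b \<cdot> c))"
    by (subst L, subst R, subst sum.swap) (simp only: tr_form_cycle)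
qed

end

section \<open>Pairs of homomorphisms to a matrix algebra\<close>

interpretation M: assoc_algebra "matrix_scale :: 'k::field \<Rightarrow> 'k^'n^'n \<Rightarrow> _" "(**)"
  by (rule assoc_algebra_matrix)

section \<open>Matrix units: primeness, trace form and centre\<close>

definition matrix_unit :: "'n \<Rightarrow> 'n \<Rightarrow> 'k::field^'n^'n" where
  "matrix_unit k l = (\<chi> i j. if i = k \<and> j = l then 1 else 0)"

lemma mult_matrix_unit: "(A ** matrix_unit k l) $ i $ j = (if j = l then A $ i $ k else 0)"
  by (cases "j = l")
    (simp_all add: matrix_matrix_mult_def matrix_unit_def if_distrib[of "(*) _"] cong: if_cong)

lemma matrix_unit_mult: "(matrix_unit k l ** A) $ i $ j = (if i = k then A $ l $ j else 0)"
  by (cases "i = k")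
    (simp_all add: matrix_matrix_mult_def matrix_unit_def if_distrib[of "\<lambda>x. x * _"] cong: if_cong)

lemma mult_matrix_unit_mult: "(A ** matrix_unit k l ** B) $ i $ j = A $ i $ k * B $ l $ j"
  by (simp add: matrix_matrix_mult_def[of "A ** matrix_unit k l"] mult_matrix_unit
      if_distrib[of "\<lambda>x. x * _"] cong: if_cong)

lemma trace_matrix_unit: "trace (matrix_unit k l) = (if k = l then 1 else 0)"
  by (cases "k = l") (auto simp: trace_def matrix_unit_def intro: sum.neutral)

lemma trace_mult_matrix_unit: "trace (A ** matrix_unit k l) = A $ l $ k"
  by (simp add: trace_def mult_matrix_unit)

text \<open>Taking matrix units for \<open>X\<close> isolates every product of an entry of
  \<open>A\<close> with an entry of \<open>B\<close>.\<close>

lemma matrix_prime: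
  fixes A B :: "'k::field^'n^'n"
  assumes "\<And>X. A ** X ** B = 0"
  shows "A = 0 \<or> B = 0"
proof -
  have "A $ i $ k * B $ l $ j = 0" for i j k l
    using assms[of "matrix_unit k l"] mult_matrix_unit_mult[of A k l B i j] by simp
  then show ?thesis by (auto simp: vec_eq_iff)
qed

lemma trace_form_nondegenerate:
  fixes A :: "'k::field^'n^'n"
  assumes "\<And>X. trace (A ** X) = 0"
  shows "A = 0"
proof -
  have "A $ l $ k = 0" for k l
    using assms[of "matrix_unit k l"] by (simp add: trace_mult_matrix_unit)
  then show ?thesis by (simp add: vec_eq_iff)
qed

lemma matrix_central_scalar:
  fixes D :: "'k::field^'n^'n"
  assumes "\<And>X. D ** X = X ** D"
  obtains c where "D = matrix_scale c (mat 1)"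
proof -
  have *: "D $ i $ k = (if i = k then D $ l $ l else 0)" for i k l
    using assms[of "matrix_unit k l"] mult_matrix_unit[of D k l i l] matrix_unit_mult[of k l D i l]
    by simp
  \<comment> \<open>Here \<open>undefined\<close> is just some index: by \<open>*\<close> all
    diagonal entries agree.\<close>
  have "D $ i $ k = matrix_scale (D $ undefined $ undefined) (mat 1) $ i $ k" for i k
    by (subst *[of i k undefined]) (simp add: matrix_scale_def mat_def)
  then have "D = matrix_scale (D $ undefined $ undefined) (mat 1)"
    unfolding vec_eq_iff by blast
  then show ?thesis by (rule that)
qed

lemma trace_sum: "trace (\<Sum>i\<in>I. f i) = (\<Sum>i\<in>I. trace (f i :: 'k::field^'n^'n))"
  by (simp add: trace_def) (rule sum.swap)

lemma trace_matrix_scale: "trace (matrix_scale c A) = c * trace A"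
  by (simp add: trace_def matrix_scale_def sum_distrib_left)

section \<open>Two homomorphisms with bijective difference\<close>

locale matrix_hom_pair = nondegenerate_algebra scale mult Basis
  for scale :: "'k::field_char_0 \<Rightarrow> 'v::ab_group_add \<Rightarrow> 'v" and mult (infixl "\<cdot>" 70) and Basis +
  fixes \<pi> \<rho> :: "'v \<Rightarrow> 'k^'n^'n"
  assumes linear_pi: "Vector_Spaces.linear scale matrix_scale \<pi>"
    and linear_rho: "Vector_Spaces.linear scale matrix_scale \<rho>"
    and pi_mult: "\<pi> (x \<cdot> y) = \<pi> x ** \<pi> y"
    and rho_mult: "\<rho> (x \<cdot> y) = \<rho> x ** \<rho> y"
    and bij_diff: "bij (\<lambda>x. \<pi> x - \<rho> x)"
begin

sublocale pi: Vector_Spaces.linear scale matrix_scale \<pi> by (rule linear_pi)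
sublocale rho: Vector_Spaces.linear scale matrix_scale \<rho> by (rule linear_rho)

lemma pi_unit_left: "\<pi> unit ** \<pi> x = \<pi> x"
  and rho_unit_left: "\<rho> unit ** \<rho> x = \<rho> x" and rho_unit_right: "\<rho> x ** \<rho> unit = \<rho> x"
  by (simp_all add: pi_mult[symmetric] rho_mult[symmetric] unit_left unit_right)

lemma diff_cases: obtains x where "X = \<pi> x - \<rho> x"
proof (rule surjE[OF bij_is_surj[OF bij_diff]])
  fix x assume "X = \<pi> x - \<rho> x"
  then show thesis by (rule that)
qed

text \<open>The left factor kills every \<open>\<pi> x\<close>, the right factor every
  \<open>\<rho> x\<close>, and every matrix is a difference of these; primeness concludes.\<close>

lemma pi_or_rho_unital: "\<pi> unit = mat 1 \<or> \<rho> unit = mat 1"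
proof -
  have "(mat 1 - \<pi> unit) ** X ** (mat 1 - \<rho> unit) = 0" for X
  proof -
    obtain x where X: "X = \<pi> x - \<rho> x" by (rule diff_cases)
    have "(mat 1 - \<pi> unit) ** \<pi> x = 0" "\<rho> x ** (mat 1 - \<rho> unit) = 0"
      by (simp_all add: M.mult_diff_left M.mult_diff_right pi_unit_left rho_unit_right)
    then show ?thesis
      by (simp add: X M.mult_diff_left M.mult_diff_right matrix_mul_assoc[symmetric])
  qed
  then have "mat 1 - \<pi> unit = 0 \<or> mat 1 - \<rho> unit = 0" by (rule matrix_prime)
  then show ?thesis by auto
qed

end

section \<open>The case of unital \<pi>\<close>

locale unital_matrix_hom_pair = matrix_hom_pair scale mult Basis \<pi> \<rho>
  for scale :: "'k::field_char_0 \<Rightarrow> 'v::ab_group_add \<Rightarrow> 'v" and mult (infixl "\<cdot>" 70) and Basis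
    and \<pi> \<rho> :: "'v \<Rightarrow> 'k^'n^'n" +
  assumes pi_unit: "\<pi> unit = mat 1"
begin

abbreviation "p \<equiv> \<rho> unit"

lemma p_not_one: "p \<noteq> mat 1"
proof
  assume "p = mat 1"
  then have "\<pi> unit - \<rho> unit = \<pi> 0 - \<rho> 0" by (simp add: pi_unit pi.zero rho.zero)
  from injD[OF bij_is_inj[OF bij_diff] this] have "unit = 0" .
  then have "mat 1 = (0 :: 'k^'n^'n)" using pi_unit pi.zero by simp
  then show False by (simp add: mat_def vec_eq_iff split: if_splits)
qed

text \<open>A commutator \<open>[D, B]\<close> is orthogonal to \<open>\<pi> A\<close> for the trace form; if moreover its corner
  \<open>p [D, B] p\<close> vanishes then it is orthogonal to \<open>\<rho> A\<close>, hence to all matrices.\<close>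

lemma commute_if_corner_zero:
  assumes D: "\<And>x. D ** \<pi> x = \<pi> x ** D" and corner: "p ** (D ** B - B ** D) ** p = 0"
  shows "D ** B = B ** D"
proof -
  define Y where "Y = D ** B - B ** D"
  have "trace (Y ** X) = 0" for X
  proof -
    obtain x where X: "X = \<pi> x - \<rho> x" by (rule diff_cases)
    have "trace (D ** B ** \<pi> x) = trace (B ** \<pi> x ** D)"
      using trace_mul_sym[of D "B ** \<pi> x"] by (simp add: matrix_mul_assoc)
    also have "\<dots> = trace (B ** D ** \<pi> x)"
      by (simp add: matrix_mul_assoc[symmetric] D)
    finally have "trace (Y ** \<pi> x) = 0" by (simp add: Y_def M.mult_diff_left trace_sub)
    \<comment> \<open>Writing \<open>\<rho> x\<close> as \<open>p ** \<rho> x ** p\<close> and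
      cycling the last \<open>p\<close> to the front produces the corner of
      \<open>Y\<close>.\<close>
    moreover have "trace (Y ** \<rho> x) = trace (Y ** p ** \<rho> x ** p)"
      by (simp add: matrix_mul_assoc[symmetric] rho_unit_left rho_unit_right)
    moreover have "\<dots> = trace (p ** Y ** p ** \<rho> x)"
      using trace_mul_sym[of "Y ** p ** \<rho> x" p] by (simp add: matrix_mul_assoc)
    ultimately show ?thesis by (simp add: X corner[folded Y_def] trace_def[of 0] M.mult_diff_right trace_sub)
  qed
  then have "Y = 0" by (rule trace_form_nondegenerate)
  then show ?thesis by (simp add: Y_def)
qed

text \<open>Vanishing corners show that \<open>D\<close> commutes first with \<open>p\<close>, then
  with every \<open>r ** X\<close>, where \<open>r = 1 - p\<close>. Hence \<open>r ** Y\<close>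
  annihilates every commutator of \<open>D\<close>, and primeness with \<open>r \<noteq> 0\<close>
  makes \<open>D\<close> central.\<close>

lemma commutant_scalar:
  assumes D: "\<And>x. D ** \<pi> x = \<pi> x ** D"
  obtains c where "D = matrix_scale c (mat 1)"
proof -
  define r where "r = mat 1 - p"
  have pp: "p ** p = p" by (rule rho_unit_left)
  have rp: "r ** p = 0" "p ** r = 0"
    by (simp_all add: r_def M.mult_diff_left M.mult_diff_right pp)
  have "p ** (D ** p - p ** D) ** p = p ** D ** (p ** p) - (p ** p) ** D ** p"
    by (simp only: M.mult_diff_left M.mult_diff_right matrix_mul_assoc)
  then have "p ** (D ** p - p ** D) ** p = 0" by (simp add: pp)
  from commute_if_corner_zero[OF D this] have "D ** p = p ** D" .
  then have Dr: "r ** D = D ** r" by (simp add: r_def M.mult_diff_left M.mult_diff_right)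
  have rX: "D ** (r ** X) = r ** X ** D" for X
  proof (rule commute_if_corner_zero[OF D])
    have "p ** (D ** (r ** X) - r ** X ** D) ** p = p ** (D ** r) ** X ** p - (p ** r) ** X ** D ** p"
      by (simp only: M.mult_diff_left M.mult_diff_right matrix_mul_assoc)
    also have "\<dots> = (p ** r) ** D ** X ** p - (p ** r) ** X ** D ** p"
      by (simp only: Dr[symmetric] matrix_mul_assoc)
    finally show "p ** (D ** (r ** X) - r ** X ** D) ** p = 0" by (simp add: rp)
  qed
  have "D ** X = X ** D" for X
  proof -
    have "r ** Y ** (D ** X - X ** D) = 0" for Y
    proof -
      \<comment> \<open>\<open>D\<close> is moved to the front past \<open>r ** Y\<close>, then to
        the back past \<open>r ** (Y ** X)\<close>.\<close>
      have "r ** Y ** (D ** X) = (r ** Y ** D) ** X" by (simp only: matrix_mul_assoc)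
      also have "\<dots> = D ** (r ** (Y ** X))" by (simp only: rX[symmetric] matrix_mul_assoc)
      also have "\<dots> = r ** Y ** (X ** D)" unfolding rX by (simp only: matrix_mul_assoc)
      finally show ?thesis by (simp add: M.mult_diff_right)
    qed
    then have "r = 0 \<or> D ** X - X ** D = 0" by (rule matrix_prime)
    then show ?thesis using p_not_one by (auto simp: r_def)
  qed
  then show ?thesis using matrix_central_scalar that by blast
qed

lemma linear_sandwich:
  fixes A B :: "'k^'n^'n"
  shows "Vector_Spaces.linear scale matrix_scale (\<lambda>y. A ** \<pi> y ** B)"
  by unfold_locales
    (simp_all add: pi.add pi.scale M.mult_add_left M.mult_add_right M.mult_scale_left M.mult_scale_right)

text \<open>Inserting \<open>X\<close> into the image of the Casimir element gives a matrix
  commuting with the image of \<pi>, hence a scalar. Taking traces determines the scalar.\<close>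

lemma casimir_scalar:
  "(\<Sum>b\<in>Basis. \<pi> (dual b) ** X ** \<pi> b) = matrix_scale (trace X / of_nat CARD('n)) (mat 1)"
proof -
  let ?C = "\<lambda>X. \<Sum>b\<in>Basis. \<pi> (dual b) ** X ** \<pi> b"
  let ?C' = "\<lambda>X. \<Sum>b\<in>Basis. \<pi> b ** X ** \<pi> (dual b)"
  have lin: "Vector_Spaces.linear scale matrix_scale (\<lambda>y. \<pi> x ** X ** \<pi> y)"
    "Vector_Spaces.linear scale matrix_scale (\<lambda>x. \<pi> x ** X ** \<pi> y)" for x y X
    using linear_sandwich[of "\<pi> x ** X" "mat 1"] linear_sandwich[of "mat 1" "X ** \<pi> y"]
    by (simp_all add: matrix_mul_assoc)
  have "?C X ** \<pi> x = \<pi> x ** ?C X" for X x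
    using casimir(2)[where F="\<lambda>x y. \<pi> x ** X ** \<pi> y" and c=x, OF lin]
    by (simp add: M.mult_sum_left M.mult_sum_right pi_mult matrix_mul_assoc)
  then have "\<exists>k. ?C X = matrix_scale k (mat 1)" for X
    using commutant_scalar[of "?C X"] by blast
  then obtain c where c: "?C X = matrix_scale (c X) (mat 1)" for X by metis
  have "?C' X ** \<pi> x = \<pi> x ** ?C' X" for X x
    using casimir(1)[where F="\<lambda>x y. \<pi> y ** X ** \<pi> x" and c=x, OF lin(2) lin(1)]
    by (simp add: M.mult_sum_left M.mult_sum_right pi_mult matrix_mul_assoc)
  then have "\<exists>k. ?C' X = matrix_scale k (mat 1)" for X
    using commutant_scalar[of "?C' X"] by blast
  then obtain c' where c': "?C' X = matrix_scale (c' X) (mat 1)" for X by metis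
  have "?C' (mat 1) = \<pi> unit" by (simp add: unit_def pi.sum pi_mult)
  then have C1: "?C' (mat 1) = mat 1" by (simp add: pi_unit)
  \<comment> \<open>Cycling the trace reverses the two Casimir factors, so that \<open>X\<close>
    splits off and the remaining sum is the image of the unit.\<close>
  have "trace (?C' (mat 1) ** X) = trace (?C X)"
  proof -
    have "trace (\<pi> b ** \<pi> (dual b) ** X) = trace (\<pi> (dual b) ** X ** \<pi> b)" for b
      using trace_mul_sym[of "\<pi> b" "\<pi> (dual b) ** X"] by (simp add: matrix_mul_assoc)
    then show ?thesis by (simp add: M.mult_sum_left trace_sum)
  qed
  then have "trace X = c X * of_nat CARD('n)"
    unfolding C1 c by (simp add: trace_matrix_scale trace_I)
  then show ?thesis by (simp add: c)
qed

text \<open>Testing \<open>casimir_scalar\<close> on matrix units gives the entrywise orthogonality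
  relations \<open>key\<close>, from which a preimage of \<open>Y\<close> can be written
  down.\<close>

lemma surj_pi: "surj \<pi>"
proof (rule surjI)
  fix Y
  \<comment> \<open>The factor \<open>CARD('n)\<close> cancels the denominator in
    \<open>key\<close>.\<close>
  let ?x = "\<Sum>b\<in>Basis. scale (of_nat CARD('n) * trace (\<pi> (dual b) ** Y)) b"
  have key: "(\<Sum>b\<in>Basis. \<pi> (dual b) $ k $ l * \<pi> b $ m $ j)
      = (if l = m \<and> k = j then 1 / of_nat CARD('n) else 0)" for k l m j
  proof -
    have "(\<Sum>b\<in>Basis. \<pi> (dual b) ** matrix_unit l m ** \<pi> b) $ k $ j
        = matrix_scale (trace (matrix_unit l m :: 'k^'n^'n) / of_nat CARD('n)) (mat 1) $ k $ j"
      by (simp only: casimir_scalar)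
    then show ?thesis
      by (auto simp: mult_matrix_unit_mult trace_matrix_unit matrix_scale_def mat_def)
  qed
  have "\<pi> ?x $ m $ j = Y $ m $ j" for m j
  proof -
    have "\<pi> ?x $ m $ j = of_nat CARD('n) *
        (\<Sum>b\<in>Basis. \<Sum>k\<in>UNIV. \<Sum>l\<in>UNIV. Y $ l $ k * (\<pi> (dual b) $ k $ l * \<pi> b $ m $ j))"
      by (simp add: pi.sum pi.scale matrix_scale_def trace_def matrix_matrix_mult_def
          sum_distrib_left sum_distrib_right ac_simps)
    also have "(\<Sum>b\<in>Basis. \<Sum>k\<in>UNIV. \<Sum>l\<in>UNIV. Y $ l $ k * (\<pi> (dual b) $ k $ l * \<pi> b $ m $ j))
        = (\<Sum>k\<in>UNIV. \<Sum>l\<in>UNIV. Y $ l $ k * (\<Sum>b\<in>Basis. \<pi> (dual b) $ k $ l * \<pi> b $ m $ j))"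
      by (subst sum.swap, intro sum.cong refl, subst sum.swap) (simp add: sum_distrib_left)
    also have "\<dots> = (\<Sum>k\<in>UNIV. if k = j then Y $ m $ j / of_nat CARD('n) else 0)"
      unfolding key by (intro sum.cong refl) (simp add: if_distrib cong: if_cong)
    finally show ?thesis by simp
  qed
  then show "\<pi> ?x = Y" by (simp add: vec_eq_iff)
qed

text \<open>The bijection \<open>\<pi> - \<rho>\<close> identifies the algebra with the matrix
  space, so \<open>f\<close> becomes an endomorphism of a finite-dimensional space.\<close>

lemma surj_iff_inj:
  assumes f: "Vector_Spaces.linear scale matrix_scale (f :: 'v \<Rightarrow> 'k^'n^'n)"
  shows "surj f \<longleftrightarrow> inj f"
proof -
  define \<phi> where "\<phi> = (\<lambda>x. \<pi> x - \<rho> x)"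
  have bij: "bij \<phi>" unfolding \<phi>_def by (rule bij_diff)
  interpret f: Vector_Spaces.linear scale matrix_scale f by (rule f)
  interpret phi: Vector_Spaces.linear scale matrix_scale \<phi>
    by unfold_locales
      (simp_all add: \<phi>_def pi.add rho.add pi.scale rho.scale M.scale_right_diff_distrib)
  have i: "inv \<phi> (\<phi> x) = x" "\<phi> (inv \<phi> X) = X" for x X
    by (simp_all add: inv_f_f bij_is_inj surj_f_inv_f bij_is_surj bij)
  have "Vector_Spaces.linear scale scale (\<lambda>x. inv \<phi> (f x))"
  proof (unfold_locales)
    fix x y c
    have "f (x + y) = \<phi> (inv \<phi> (f x) + inv \<phi> (f y))" by (simp add: i phi.add f.add)
    then show "inv \<phi> (f (x + y)) = inv \<phi> (f x) + inv \<phi> (f y)" by (simp only: i)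
    have "f (scale c x) = \<phi> (scale c (inv \<phi> (f x)))" by (simp add: i phi.scale f.scale)
    then show "inv \<phi> (f (scale c x)) = scale c (inv \<phi> (f x))" by (simp only: i)
  qed
  from linear_inj_imp_surj[OF this] linear_surj_imp_inj[OF this]
  have "surj (inv \<phi> \<circ> f) \<longleftrightarrow> inj (inv \<phi> \<circ> f)" by (auto simp: o_def)
  moreover have "f = \<phi> \<circ> (inv \<phi> \<circ> f)" by (simp add: fun_eq_iff i)
  ultimately show ?thesis
    using bij by (metis bij_imp_bij_inv bij_is_inj bij_is_surj comp_surj inj_compose)
qed

text \<open>Since \<open>\<pi>\<close> is an isomorphism, the algebra is simple, so \<open>\<rho>\<close> vanishes or is injective; in the
  latter case it would be onto, hence unital.\<close>

lemma rho_zero: "\<rho> x = 0"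
proof -
  have inj_pi: "inj \<pi>" using surj_iff_inj[OF linear_pi] surj_pi by simp
  have "\<not> inj \<rho>"
  proof
    assume "inj \<rho>"
    then have "surj \<rho>" using surj_iff_inj[OF linear_rho] by simp
    then obtain z where "\<rho> z = mat 1" by (metis surjD)
    then show False using rho_unit_left[of z] p_not_one by simp
  qed
  then obtain z where z: "z \<noteq> 0" "\<rho> z = 0"
    using rho.inj_iff_eq_0 by blast
  then have "\<pi> z \<noteq> 0" using inj_pi pi.zero by (metis injD)
  then obtain k l where kl: "\<pi> z $ k $ l \<noteq> 0" by (auto simp: vec_eq_iff)
  define e where "e i j = inv \<pi> (matrix_unit i j)" for i j
  have e: "\<pi> (e i j) = matrix_unit i j" for i j
    unfolding e_def by (rule surj_f_inv_f[OF surj_pi])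
  \<comment> \<open>Sandwiching by matrix units moves the nonzero entry of \<open>\<pi> z\<close> to
    every diagonal position. Thus a nonzero multiple of the unit lies in the ideal generated by
    \<open>z\<close>, which \<rho> kills.\<close>
  let ?s = "\<Sum>i\<in>UNIV. e i k \<cdot> z \<cdot> e l i"
  have "\<pi> ?s = (\<Sum>i\<in>UNIV. matrix_unit i k ** \<pi> z ** matrix_unit l i)"
    by (simp add: pi.sum pi_mult e)
  also have "\<dots> = matrix_scale (\<pi> z $ k $ l) (mat 1)"
    by (simp add: vec_eq_iff mult_matrix_unit matrix_unit_mult matrix_scale_def mat_def)
  also have "\<dots> = \<pi> (scale (\<pi> z $ k $ l) unit)"
    by (simp add: pi.scale pi_unit)
  finally have "?s = scale (\<pi> z $ k $ l) unit" by (rule injD[OF inj_pi])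
  then have "matrix_scale (\<pi> z $ k $ l) p = \<rho> ?s" by (simp add: rho.scale)
  also have "\<dots> = 0" by (simp add: rho.sum rho_mult z)
  finally have "p = 0" using kl by (simp add: matrix_scale_def vec_eq_iff)
  then show ?thesis using rho_unit_left[of x] by simp
qed

end

text \<open>Negating the difference exchanges the roles of \<pi> and \<rho>, so the unital case
  applies to either.\<close>

lemma (in matrix_hom_pair) pi_or_rho_zero: "(\<forall>x. \<rho> x = 0) \<or> (\<forall>x. \<pi> x = 0)"
  using pi_or_rho_unital
proof
  assume "\<pi> unit = mat 1"
  then interpret unital_matrix_hom_pair scale mult Basis \<pi> \<rho> by unfold_locales
  show ?thesis using rho_zero by blast
next
  assume rho_unit: "\<rho> unit = mat 1"
  have "bij (\<lambda>x. \<rho> x - \<pi> x)"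
  proof -
    have "bij (uminus \<circ> (\<lambda>x. \<pi> x - \<rho> x))"
      using bij_diff bij_uminus by (rule bij_comp)
    then show ?thesis by (simp add: o_def)
  qed
  then interpret swap: unital_matrix_hom_pair scale mult Basis \<rho> \<pi>
    by unfold_locales (simp_all add: pi_mult rho_mult rho_unit)
  show ?thesis using swap.rho_zero by blast
qed

section \<open>From the post-associative structure to a pair of homomorphisms\<close>

theorem corollary3p4:
  fixes scale :: "complex \<Rightarrow> 'v::ab_group_add \<Rightarrow> 'v"
    and multA :: "'v \<Rightarrow> 'v \<Rightarrow> 'v"  (infixl "\<cdot>\<^sub>A" 70)
    and multB :: "'v \<Rightarrow> 'v \<Rightarrow> 'v"  (infixl "\<cdot>\<^sub>B" 70)
    and succ :: "'v \<Rightarrow> 'v \<Rightarrow> 'v"  (infixl "\<succ>" 70)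
    and prec :: "'v \<Rightarrow> 'v \<Rightarrow> 'v"  (infixl "\<prec>" 70)
  assumes "vector_space scale"
    and "semisimple_algebra scale (\<cdot>\<^sub>A)"
    and "assoc_algebra scale (\<cdot>\<^sub>B)"
    and "algebra_isomorphic scale (\<cdot>\<^sub>B) matrix_scale ((**) :: complex^'n^'n \<Rightarrow> _)"
    and "post_associative_structure scale (\<cdot>\<^sub>A) (\<cdot>\<^sub>B) (\<succ>) (\<prec>)"
  shows "algebra_isomorphic scale (\<cdot>\<^sub>A) scale (\<cdot>\<^sub>B) \<and>
    ((\<forall>x y. x \<succ> y = 0 \<and> x \<prec> y = 0 \<and> x \<cdot>\<^sub>B y = x \<cdot>\<^sub>A y) \<or>
     (\<forall>x y. x \<cdot>\<^sub>A y = - (x \<cdot>\<^sub>B y) \<and> x \<succ> y = - (x \<cdot>\<^sub>B y) \<and> x \<prec> y = - (x \<cdot>\<^sub>B y)))"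
proof -
  interpret S: semisimple_algebra scale "(\<cdot>\<^sub>A)" by fact
  interpret P: post_associative_structure scale multA multB succ prec by fact
  obtain Basis where "finite_dimensional_vector_space scale Basis"
    using S.finite_dimensional by blast
  then interpret F: finite_dimensional_vector_space scale Basis .
  interpret C: fd_assoc_algebra_char_0 scale "(\<cdot>\<^sub>A)" Basis by unfold_locales
  interpret N: nondegenerate_algebra scale "(\<cdot>\<^sub>A)" Basis
    by unfold_locales (rule C.tr_form_nondegenerate[OF S.radical_zero])
  obtain \<phi> :: "'v \<Rightarrow> complex^'n^'n" where lin_phi: "Vector_Spaces.linear scale matrix_scale \<phi>"
    and bij: "bij \<phi>" and phi_mult: "\<And>x y. \<phi> (x \<cdot>\<^sub>B y) = \<phi> x ** \<phi> y"
    using assms(4) by (auto simp: algebra_isomorphic_def)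
  interpret phi: Vector_Spaces.linear scale matrix_scale \<phi> by (rule lin_phi)
  have inj: "\<phi> x = \<phi> y \<longleftrightarrow> x = y" for x y by (rule inj_eq[OF bij_is_inj[OF bij]])
  define e where "e = inv \<phi> (mat 1)"
  have e: "\<phi> e = mat 1" unfolding e_def by (rule surj_f_inv_f[OF bij_is_surj[OF bij]])
  have eB: "e \<cdot>\<^sub>B x = x" "x \<cdot>\<^sub>B e = x" for x
    by (simp_all add: inj[symmetric] phi_mult e)
  \<comment> \<open>This is the operator \<open>T\<close> of the introduction, transported to
    matrices by \<open>\<phi>\<close>; \<open>e\<close> is the unit of \<open>B\<close>.\<close>
  define \<rho> where "\<rho> x = \<phi> (x \<succ> e)" for x
  define \<pi> where "\<pi> x = \<phi> x + \<rho> x" for x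
  have phi_succ: "\<phi> (x \<succ> y) = \<rho> x ** \<phi> y" for x y
    using P.succ_multB[of x e y] by (simp add: eB \<rho>_def phi_mult)
  \<comment> \<open>With \<open>e\<close> in both outer places, the mixed axiom shows that a single
    operator governs both products.\<close>
  have "e \<prec> x = x \<succ> e" for x
    using P.prec_multB[of e x e] by (simp add: eB)
  then have phi_prec: "\<phi> (x \<prec> y) = \<phi> x ** \<rho> y" for x y
    using P.multB_prec[of x e y] by (simp add: eB \<rho>_def phi_mult)
  have "x \<cdot>\<^sub>A y = x \<cdot>\<^sub>B y + x \<succ> y + x \<prec> y" for x y
    using P.diff_eq[of x y] by (simp add: algebra_simps)
  then have phi_A: "\<phi> (x \<cdot>\<^sub>A y) = \<phi> x ** \<phi> y + \<rho> x ** \<phi> y + \<phi> x ** \<rho> y" for x y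
    by (simp add: phi.add phi_mult phi_succ phi_prec)
  have rho_A: "\<rho> (x \<cdot>\<^sub>A y) = \<rho> x ** \<rho> y" for x y
    using P.multA_succ[of x y e] by (simp add: \<rho>_def[of "_ \<cdot>\<^sub>A _"] phi_succ e)
  \<comment> \<open>The three terms of \<open>phi_A\<close> together with
    \<open>\<rho> x ** \<rho> y\<close> factor as a product of sums.\<close>
  have pi_A: "\<pi> (x \<cdot>\<^sub>A y) = \<pi> x ** \<pi> y" for x y
    by (simp add: \<pi>_def phi_A rho_A M.mult_add_left M.mult_add_right)
  interpret succ_e: Vector_Spaces.linear scale scale "\<lambda>x. x \<succ> e"
    using P.bilinear_succ by (simp add: S.bilinear_product_def)
  have lin_rho: "Vector_Spaces.linear scale matrix_scale \<rho>"
    by unfold_locales (simp_all add: \<rho>_def succ_e.add succ_e.scale phi.add phi.scale)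
  then interpret rho: Vector_Spaces.linear scale matrix_scale \<rho> .
  have lin_pi: "Vector_Spaces.linear scale matrix_scale \<pi>"
    by unfold_locales
      (simp_all add: \<pi>_def rho.add rho.scale phi.add phi.scale M.scale_right_distrib)
  then interpret pi: Vector_Spaces.linear scale matrix_scale \<pi> .
  have "bij (\<lambda>x. \<pi> x - \<rho> x)" using bij by (simp add: \<pi>_def)
  then interpret H: matrix_hom_pair scale "(\<cdot>\<^sub>A)" Basis \<pi> \<rho>
    by unfold_locales (simp_all add: pi_A rho_A)
  from H.pi_or_rho_zero show ?thesis
  proof
    assume rho: "\<forall>x. \<rho> x = 0"
    then have *: "x \<succ> y = 0 \<and> x \<prec> y = 0 \<and> x \<cdot>\<^sub>B y = x \<cdot>\<^sub>A y" for x y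
      by (simp add: inj[symmetric] phi_succ phi_prec phi_A phi_mult phi.zero)
    have "algebra_isomorphic scale (\<cdot>\<^sub>A) scale (\<cdot>\<^sub>B)"
      unfolding algebra_isomorphic_def
      by (rule exI[of _ id]) (simp add: * S.linear_id)
    with * show ?thesis by blast
  next
    assume "\<forall>x. \<pi> x = 0"
    then have rho: "\<rho> x = - \<phi> x" for x by (simp add: \<pi>_def eq_neg_iff_add_eq_0 add.commute)
    have neg: "(- X) ** Y = - (X ** Y)" "X ** (- Y) = - (X ** Y)" for X Y :: "complex^'n^'n"
      using M.mult_diff_left[of 0 X Y] M.mult_diff_right[of X 0 Y] by simp_all
    have *: "x \<cdot>\<^sub>A y = - (x \<cdot>\<^sub>B y) \<and> x \<succ> y = - (x \<cdot>\<^sub>B y) \<and> x \<prec> y = - (x \<cdot>\<^sub>B y)" for x y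
      by (simp add: inj[symmetric] phi_succ phi_prec phi_A phi_mult phi.neg rho neg)
    \<comment> \<open>As the products differ by a sign, negation is the isomorphism: its two signs
      cancel in a product of \<open>B\<close>.\<close>
    have "algebra_isomorphic scale (\<cdot>\<^sub>A) scale (\<cdot>\<^sub>B)"
      unfolding algebra_isomorphic_def
    proof (intro exI[of _ uminus] conjI allI)
      show "Vector_Spaces.linear scale scale uminus"
        by unfold_locales (simp_all add: S.scale_minus_right)
      show "- (x \<cdot>\<^sub>A y) = - x \<cdot>\<^sub>B - y" for x y
        by (simp add: * inj[symmetric] phi_mult phi.neg neg)
    qed (rule bij_uminus)
    with * show ?thesis by blast
  qed
qed
end
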